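(* Let $\mathcal{T}_0$ be an arbitrary tree, let $(\mathcal{T}_t)_{t\ge0}$ be the sequence of trees generated from the seed $\mathcal{T}_0$ by Algorithm-I, and let $D_t$ denote the diameter of $\mathcal{T}_t$ (so $D_0$ is the diameter of the seed $\mathcal{T}_0$). Then the diameter of $\mathcal{T}_t$ is given by $$D_t=3^{t}(D_0+1)-1.$$
   Context: Algorithm-I: given a tree $\mathcal{T}_{t-1}$ ($t\ge1$), with $k_v(t-1)$ denoting the degree of vertex $v$ in $\mathcal{T}_{t-1}$, the tree $\mathcal{T}_t$ is obtained by two operations: (i) for each vertex $v$ of $\mathcal{T}_{t-1}$, insert one new vertex into each edge incident with $v$, so that every edge $uv$ of $\mathcal{T}_{t-1}$ receives two new vertices (one for each endpoint) and is replaced by a path $u,u',v',v$ of length $3$; (ii) for each vertex $v$ of $\mathcal{T}_{t-1}$, attach $k_v(t-1)$ new vertices as leaves to $v$. The diameter of a network is the length of the longest shortest path over all pairs of vertices.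
   Formalization: The seed tree is required to have at least two vertices: for the one-vertex tree the algorithm adds nothing, so the diameter stays 0 while the formula would give 3^t − 1. *)

theory Defs
  imports "Graph_Theory.Graph_Theory"
begin

text \<open>
  Finite simple undirected graphs are represented by the locale predicate \<^const>\<open>pair_graph\<close>:
  each edge $uv$ is the pair of opposite arcs \<open>(u, v)\<close>, \<open>(v, u)\<close>, so the degree of a vertex is
  its out-degree.

  The library predicate \<^const>\<open>tree\<close> is not usable for this representation: it forbids every
  directed cycle, including the back-and-forth walk \<open>[(u, v), (v, u)]\<close> along a single edge. A cycle
  of an undirected graph has length at least 3.
\<close>

definition undirected_tree :: "'a pair_pre_digraph \<Rightarrow> bool" where
  "undirected_tree G \<longleftrightarrow>
     pair_graph G \<and> connected (with_proj G) \<and>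
     \<not> (\<exists>p. pre_digraph.cycle (with_proj G) p \<and> 3 \<le> length p)"

definition shortest_path :: "'a pair_pre_digraph \<Rightarrow> 'a \<Rightarrow> ('a \<times> 'a) list \<Rightarrow> 'a \<Rightarrow> bool" where
  "shortest_path G u p v \<longleftrightarrow>
     pre_digraph.apath (with_proj G) u p v \<and>
     (\<forall>q. pre_digraph.apath (with_proj G) u q v \<longrightarrow> length p \<le> length q)"

definition graph_diameter :: "'a pair_pre_digraph \<Rightarrow> nat" where
  "graph_diameter G = Max {length p |u p v. shortest_path G u p v}"

text \<open>
  The slots \<open>(v, i)\<close> with \<open>i\<close> below the degree of \<open>v\<close> index the leaves attached to \<open>v\<close>.
\<close>

definition leaf_slots :: "'a pair_pre_digraph \<Rightarrow> ('a \<times> nat) set" where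
  "leaf_slots G = (SIGMA v : pverts G. {..<out_degree (with_proj G) v})"

text \<open>
  \<open>algorithm_I G H\<close>: the graph \<open>H\<close> is obtained from \<open>G\<close> by one step of the algorithm, for some
  choice of the new vertices. The vertex \<open>ins (u, v)\<close> is the one inserted into the edge $uv$ on
  behalf of its endpoint \<open>u\<close>, so that $uv$ becomes the path
  \<open>u, ins (u, v), ins (v, u), v\<close>; the vertices \<open>leaf (v, i)\<close> are the leaves attached to \<open>v\<close>.
  The converse in the last clause only adds the opposite arcs.
\<close>

definition algorithm_I :: "'a pair_pre_digraph \<Rightarrow> 'a pair_pre_digraph \<Rightarrow> bool" where
  "algorithm_I G H \<longleftrightarrow>
     (\<exists>(ins :: 'a \<times> 'a \<Rightarrow> 'a) (leaf :: 'a \<times> nat \<Rightarrow> 'a).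
        inj_on ins (parcs G) \<and> inj_on leaf (leaf_slots G) \<and>
        ins ` parcs G \<inter> pverts G = {} \<and>
        leaf ` leaf_slots G \<inter> pverts G = {} \<and>
        ins ` parcs G \<inter> leaf ` leaf_slots G = {} \<and>
        pverts H = pverts G \<union> ins ` parcs G \<union> leaf ` leaf_slots G \<and>
        (let E = {(u, ins (u, v)) |u v. (u, v) \<in> parcs G} \<union>
                 {(ins (u, v), ins (v, u)) |u v. (u, v) \<in> parcs G} \<union>
                 {(v, leaf (v, i)) |v i. (v, i) \<in> leaf_slots G}
         in parcs H = E \<union> E\<inverse>))"

text \<open>
  Over an infinite vertex type there is always room for the new vertices, so every finite graph is
  the seed of some sequence generated by the algorithm.
\<close>

lemma algorithm_I_step_exists:
  fixes G :: "'a pair_pre_digraph"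
  assumes inf: "infinite (UNIV :: 'a set)" and fin: "finite (pverts G)" "finite (parcs G)"
  shows "\<exists>H. algorithm_I G H \<and> finite (pverts H) \<and> finite (parcs H)"
proof -
  define A where "A = Inl ` parcs G \<union> Inr ` leaf_slots G"
  have finL: "finite (leaf_slots G)"
    using fin by (simp add: leaf_slots_def)
  then have finA: "finite A"
    using fin by (simp add: A_def)
  have "infinite (UNIV - pverts G)"
    using inf fin by simp
  then obtain B where B: "finite B" "card B = card A" "B \<subseteq> UNIV - pverts G"
    by (meson infinite_arbitrarily_large)
  then obtain f where f: "bij_betw f A B"
    using finA by (metis finite_same_card_bij)
  define ins where "ins x = f (Inl x)" for x
  define leaf where "leaf x = f (Inr x)" for x
  define E where "E = {(u, ins (u, v)) |u v. (u, v) \<in> parcs G} \<union>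
                 {(ins (u, v), ins (v, u)) |u v. (u, v) \<in> parcs G} \<union>
                 {(v, leaf (v, i)) |v i. (v, i) \<in> leaf_slots G}"
  define H where "H = \<lparr>pverts = pverts G \<union> ins ` parcs G \<union> leaf ` leaf_slots G,
    parcs = E \<union> E\<inverse>\<rparr>"
  have injf: "inj_on f A" and imf: "f ` A = B"
    using f by (auto simp: bij_betw_def)
  have 1: "inj_on ins (parcs G)" "inj_on leaf (leaf_slots G)"
    using injf by (auto simp: inj_on_def ins_def leaf_def A_def)
  have "ins ` parcs G \<subseteq> B" "leaf ` leaf_slots G \<subseteq> B"
    using imf by (auto simp: ins_def leaf_def A_def)
  then have 2: "ins ` parcs G \<inter> pverts G = {}" "leaf ` leaf_slots G \<inter> pverts G = {}"
    using B by auto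
  have 3: "ins ` parcs G \<inter> leaf ` leaf_slots G = {}"
    using injf by (force simp: inj_on_def ins_def leaf_def A_def)
  have "algorithm_I G H"
    unfolding algorithm_I_def
    by (rule exI[of _ ins], rule exI[of _ leaf]) (use 1 2 3 in \<open>simp add: H_def E_def Let_def\<close>)
  moreover have "E = (\<lambda>(u, v). (u, ins (u, v))) ` parcs G \<union>
      (\<lambda>(u, v). (ins (u, v), ins (v, u))) ` parcs G \<union> (\<lambda>(v, i). (v, leaf (v, i))) ` leaf_slots G"
    unfolding E_def by (auto simp: image_iff split: prod.splits; force)
  then have "finite E"
    using fin finL by simp
  ultimately show ?thesis
    using fin finL by (intro exI[of _ H]) (simp add: H_def)
qed

lemma algorithm_I_sequence_exists:
  fixes G :: "'a pair_pre_digraph"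
  assumes inf: "infinite (UNIV :: 'a set)" and fin: "finite (pverts G)" "finite (parcs G)"
  shows "\<exists>T. T 0 = G \<and> (\<forall>t. algorithm_I (T t) (T (Suc t)))"
proof -
  let ?P = "\<lambda>n (H :: 'a pair_pre_digraph).
    finite (pverts H) \<and> finite (parcs H) \<and> (n = 0 \<longrightarrow> H = G)"
  have "\<exists>T. \<forall>n. ?P n (T n) \<and> algorithm_I (T n) (T (Suc n))"
  proof (rule dependent_nat_choice)
    show "\<exists>H. ?P 0 H"
      using fin by auto
    show "\<exists>K. ?P (Suc n) K \<and> algorithm_I H K" if "?P n H" for H n
      using algorithm_I_step_exists[OF inf] that by fastforce
  qed
  then show ?thesis by blast
qed

end

theory Submission
  imports Defs
begin

text \<open>
  Every edge becomes a path of length 3, so distances between old vertices are multiplied by 3.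
  Every new vertex is adjacent to an old one, which bounds the new diameter by \<open>3 D + 2\<close>. The
  bound is attained by leaves attached to two old vertices at distance \<open>D\<close>. Hence
  \<open>D + 1\<close> is multiplied by 3 in each step.
\<close>

definition has_diameter :: "'a pair_pre_digraph \<Rightarrow> nat \<Rightarrow> bool" where
  "has_diameter G D \<longleftrightarrow>
     (\<forall>u\<in>pverts G. \<forall>v\<in>pverts G. \<exists>n\<le>D. (u, v) \<in> parcs G ^^ n) \<and>
     (\<exists>u\<in>pverts G. \<exists>v\<in>pverts G. \<forall>n<D. (u, v) \<notin> parcs G ^^ n)"

section \<open>Walks, paths and powers of the arc relation\<close>

context pair_wf_digraph
begin

lemma awalk_imp_relpow: "awalk u p v \<Longrightarrow> (u, v) \<in> parcs G ^^ length p"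
proof (induction p arbitrary: u)
  case Nil
  then show ?case by (simp add: awalk_Nil_iff)
next
  case (Cons e p)
  then have "(u, snd e) \<in> parcs G" "(snd e, v) \<in> parcs G ^^ length p"
    by (auto simp: awalk_Cons_iff)
  then show ?case
    by (metis relpow_Suc_I2 length_Cons)
qed

text \<open>The start must be assumed a vertex because the zeroth power relates every element of the
  type to itself.\<close>

lemma relpow_imp_awalk:
  assumes "(u, v) \<in> parcs G ^^ n" "u \<in> pverts G"
  shows "\<exists>p. awalk u p v \<and> length p = n"
  using assms
proof (induction n arbitrary: u)
  case 0
  then show ?case by (auto simp: awalk_Nil_iff)
next
  case (Suc n)
  then obtain w where w: "(u, w) \<in> parcs G" "(w, v) \<in> parcs G ^^ n"
    by (meson relpow_Suc_D2)
  then obtain p where "awalk w p v" "length p = n"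
    using Suc.IH in_arcsD2 by blast
  with w have "awalk u ((u, w) # p) v \<and> length ((u, w) # p) = Suc n"
    by (auto simp: awalk_Cons_iff)
  then show ?case by blast
qed

text \<open>A walk that repeats a vertex contains a nonempty closed part \<open>r\<close>; cutting
  it out leaves a strictly shorter walk, so strong induction on the length applies.\<close>

lemma relpow_imp_apath:
  assumes "(u, v) \<in> parcs G ^^ n" "u \<in> pverts G"
  shows "\<exists>p. apath u p v \<and> length p \<le> n"
  using assms
proof (induction n rule: less_induct)
  case (less n)
  obtain p where p: "awalk u p v" "length p = n"
    using relpow_imp_awalk less.prems by blast
  show ?case
  proof (cases "distinct (awalk_verts u p)")
    case True
    then show ?thesis using p by (auto simp: apath_def)
  next
    case False
    then obtain q r s where "p = q @ r @ s" "0 < length r" "awalk u (q @ s) v"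
      using awalk_not_distinct_decomp[OF p(1)] awalk_appendI by blast
    then have "length (q @ s) < n" "(u, v) \<in> parcs G ^^ length (q @ s)"
      using p(2) awalk_imp_relpow[of u "q @ s" v] by (simp_all del: length_greater_0_conv)
    then show ?thesis
      using less.IH less.prems(2) by (meson le_less_trans less_imp_le)
  qed
qed

lemma shortest_path_exists:
  assumes "(u, v) \<in> parcs G ^^ n" "u \<in> pverts G"
  shows "\<exists>p. shortest_path G u p v"
proof -
  obtain p where "apath u p v"
    using relpow_imp_apath assms by blast
  then show ?thesis
    unfolding shortest_path_def using ex_has_least_nat[of "\<lambda>p. apath u p v" p length] by blast
qed

text \<open>Every walk contains a path that is no longer, so shortest paths are also shortest walks.
  The bound \<open>D\<close> on their lengths makes the set under \<open>Max\<close> finite, and a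
  sharp pair attains it.\<close>

lemma graph_diameter_eqI:
  assumes "has_diameter G D"
  shows "graph_diameter G = D"
proof -
  have le: "length p \<le> D" if "shortest_path G u p v" for u p v
  proof -
    have ap: "apath u p v" and min: "\<And>q. apath u q v \<Longrightarrow> length p \<le> length q"
      using that by (auto simp: shortest_path_def)
    have "u \<in> pverts G" "v \<in> pverts G"
      using ap awalkI_apath awalk_hd_in_verts awalk_last_in_verts by blast+
    then obtain n where n: "n \<le> D" "(u, v) \<in> parcs G ^^ n" "u \<in> pverts G"
      using assms unfolding has_diameter_def by blast
    obtain q where "apath u q v" "length q \<le> n"
      using relpow_imp_apath n by blast
    then show ?thesis
      using min n by fastforce
  qed
  obtain u v where uv: "u \<in> pverts G" "v \<in> pverts G" "\<And>n. n < D \<Longrightarrow> (u, v) \<notin> parcs G ^^ n"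
    using assms by (auto simp: has_diameter_def)
  then obtain n where "(u, v) \<in> parcs G ^^ n"
    using assms unfolding has_diameter_def by blast
  then obtain p where p: "shortest_path G u p v"
    using shortest_path_exists uv by blast
  then have "(u, v) \<in> parcs G ^^ length p"
    by (auto simp: shortest_path_def intro: awalk_imp_relpow awalkI_apath)
  then have "length p = D"
    using uv le[OF p] by (meson le_neq_implies_less)
  then show ?thesis
    unfolding graph_diameter_def using le p by (intro Max_eqI) (auto intro: finite_subset[of _ "{..D}"])
qed

end

section \<open>Diameter of the seed\<close>

text \<open>Path lengths are bounded by the number of vertices, so some uniform bound exists, and
  \<open>D\<close> is the least one. Two distinct vertices exclude \<open>D = 0\<close>.\<close>

lemma (in pair_graph) has_diameter_exists:
  assumes conn: "connected (with_proj G)" and card: "card (pverts G) \<ge> 2"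
  shows "\<exists>D\<ge>1. has_diameter G D"
proof -
  define P where "P D \<longleftrightarrow> (\<forall>u\<in>pverts G. \<forall>v\<in>pverts G. \<exists>n\<le>D. (u, v) \<in> parcs G ^^ n)" for D
  have "P (card (pverts G))"
    unfolding P_def
  proof (intro ballI)
    fix u v assume "u \<in> pverts G" "v \<in> pverts G"
    then have "reachable (mk_symmetric G) u v"
      using conn by (simp add: connected_def strongly_connected_def)
    then have "reachable G u v"
      using reachable_mk_symmetric_eq sym_arcs by blast
    then obtain p where p: "apath u p v"
      using reachable_apath by blast
    then show "\<exists>n\<le>card (pverts G). (u, v) \<in> parcs G ^^ n"
      using length_apath[OF p] awalk_imp_relpow awalkI_apath by blast
  qed
  then obtain D where D: "P D" "\<And>E. E < D \<Longrightarrow> \<not> P E"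
    using exists_least_iff[of P] by blast
  have "\<not> card (pverts G) \<le> 1" "finite (pverts G)"
    using card pair_finite_verts by auto
  then obtain x y where xy: "x \<in> pverts G" "y \<in> pverts G" "x \<noteq> y"
    by (metis card_le_Suc0_iff_eq One_nat_def)
  have "D \<noteq> 0"
  proof
    assume "D = 0"
    then have "(x, y) \<in> parcs G ^^ 0"
      using D(1) xy unfolding P_def by (metis le_zero_eq)
    then show False using xy by simp
  qed
  \<comment> \<open>For \<open>D = 0\<close> the truncated \<open>D - 1\<close> would be
    \<open>D\<close> itself and minimality would say nothing.\<close>
  then have "\<not> P (D - 1)"
    using D(2) by simp
  then obtain u v where "u \<in> pverts G" "v \<in> pverts G" "\<forall>n\<le>D - 1. (u, v) \<notin> parcs G ^^ n"
    by (auto simp: P_def)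
  moreover have "n \<le> D - 1" if "n < D" for n
    using that by simp
  ultimately have "has_diameter G D"
    using D(1) unfolding has_diameter_def P_def by blast
  then show ?thesis
    using \<open>D \<noteq> 0\<close> by (intro exI[of _ D]) simp
qed

lemma relpow_converse_sym:
  assumes "sym R" "(x, y) \<in> R ^^ n"
  shows "(y, x) \<in> R ^^ n"
  using assms(2)
proof (induction n arbitrary: y)
  case (Suc n)
  then show ?case
    by (meson assms(1) relpow_Suc_E relpow_Suc_I2 symD)
qed simp

section \<open>Lower bounds on walk lengths by 1-Lipschitz functions\<close>

lemma relpow_lipschitz:
  fixes f :: "'a \<Rightarrow> int"
  assumes "\<And>x y. (x, y) \<in> R \<Longrightarrow> f y \<le> f x + 1" and "(x, y) \<in> R ^^ n"
  shows "f y \<le> f x + int n"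
  using assms(2)
proof (induction n arbitrary: y)
  case (Suc n)
  then obtain z where "(x, z) \<in> R ^^ n" "(z, y) \<in> R"
    by (meson relpow_Suc_E)
  then show ?case
    using Suc.IH assms(1) by fastforce
qed simp

section \<open>One step of the algorithm\<close>

locale algorithm_I_step = pair_graph G for G :: "'a pair_pre_digraph" +
  fixes H :: "'a pair_pre_digraph" and ins :: "'a \<times> 'a \<Rightarrow> 'a" and leaf :: "'a \<times> nat \<Rightarrow> 'a"
  assumes inj_ins: "inj_on ins (parcs G)" and inj_leaf: "inj_on leaf (leaf_slots G)"
    and ins_verts: "ins ` parcs G \<inter> pverts G = {}"
    and leaf_verts: "leaf ` leaf_slots G \<inter> pverts G = {}"
    and ins_leaf: "ins ` parcs G \<inter> leaf ` leaf_slots G = {}"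
    and pverts_H: "pverts H = pverts G \<union> ins ` parcs G \<union> leaf ` leaf_slots G"
    and let_parcs_H: "let E = {(u, ins (u, v)) |u v. (u, v) \<in> parcs G} \<union>
                 {(ins (u, v), ins (v, u)) |u v. (u, v) \<in> parcs G} \<union>
                 {(v, leaf (v, i)) |v i. (v, i) \<in> leaf_slots G}
         in parcs H = E \<union> E\<inverse>"
begin

lemmas parcs_H = let_parcs_H[unfolded Let_def]

text \<open>Five cases suffice for the six kinds of arc: since \<open>G\<close> is symmetric, the
  reverse of a middle arc is the middle arc of the opposite arc of \<open>G\<close>.\<close>

lemma arcs_H_cases:
  assumes "(x, y) \<in> parcs H"
  obtains (ins1) u v where "(u, v) \<in> parcs G" "x = u" "y = ins (u, v)"
    | (ins2) u v where "(u, v) \<in> parcs G" "y = u" "x = ins (u, v)"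
    | (mid) u v where "(u, v) \<in> parcs G" "(v, u) \<in> parcs G" "x = ins (u, v)" "y = ins (v, u)"
    | (leaf1) v i where "(v, i) \<in> leaf_slots G" "x = v" "y = leaf (v, i)"
    | (leaf2) v i where "(v, i) \<in> leaf_slots G" "y = v" "x = leaf (v, i)"
  using assms unfolding parcs_H Un_iff converse_iff mem_Collect_eq prod.inject
proof (elim disjE exE conjE)
  fix u v assume "(u, v) \<in> parcs G" "x = u" "y = ins (u, v)"
  then show thesis by (rule ins1)
next
  fix u v assume "(u, v) \<in> parcs G" "y = u" "x = ins (u, v)"
  then show thesis by (rule ins2)
next
  fix u v assume "(u, v) \<in> parcs G" "x = ins (u, v)" "y = ins (v, u)"
  then show thesis using arcs_symmetric by (intro mid)
next
  fix u v assume "(u, v) \<in> parcs G" "y = ins (u, v)" "x = ins (v, u)"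
  then show thesis using arcs_symmetric by (intro mid[of v u])
next
  fix v i assume "(v, i) \<in> leaf_slots G" "x = v" "y = leaf (v, i)"
  then show thesis by (rule leaf1)
next
  fix v i assume "(v, i) \<in> leaf_slots G" "y = v" "x = leaf (v, i)"
  then show thesis by (rule leaf2)
qed

lemma arcs_HI:
  "(u, v) \<in> parcs G \<Longrightarrow> (u, ins (u, v)) \<in> parcs H"
  "(u, v) \<in> parcs G \<Longrightarrow> (ins (u, v), ins (v, u)) \<in> parcs H"
  "(v, i) \<in> leaf_slots G \<Longrightarrow> (v, leaf (v, i)) \<in> parcs H"
  unfolding parcs_H by blast+

lemma sym_H: "sym (parcs H)"
  unfolding parcs_H by (rule sym_Un_converse)

lemma slot_vert: "(v, i) \<in> leaf_slots G \<Longrightarrow> v \<in> pverts G"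
  by (auto simp: leaf_slots_def)

text \<open>A vertex with a neighbour has positive degree, so at least one leaf is attached to
  it.\<close>

lemma slot_0: "(u, v) \<in> parcs G \<Longrightarrow> (u, 0) \<in> leaf_slots G"
proof -
  assume uv: "(u, v) \<in> parcs G"
  then have "(u, v) \<in> out_arcs G u" "finite (out_arcs G u)"
    using pair_finite_arcs by (auto simp: out_arcs_def)
  then have "out_degree G u > 0"
    unfolding out_degree_def card_gt_0_iff by blast
  then show ?thesis
    using uv in_arcsD1 by (auto simp: leaf_slots_def)
qed

lemma pair_graph_H: "pair_graph H"
proof
  have slots: "finite (leaf_slots G)"
    using pair_finite_verts by (simp add: leaf_slots_def)
  show fin: "finite (pverts H)"
    using pair_finite_verts pair_finite_arcs slots by (simp add: pverts_H)
  have "x \<in> pverts H \<and> y \<in> pverts H" if "(x, y) \<in> parcs H" for x y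
    using that
    by (cases rule: arcs_H_cases) (auto simp: pverts_H dest: in_arcsD1 slot_vert)
  then show e: "fst e \<in> pverts H" "snd e \<in> pverts H" if "e \<in> parcs H" for e
    using that by (cases e; simp)+
  then have "parcs H \<subseteq> pverts H \<times> pverts H"
    by (auto simp: mem_Times_iff)
  then show "finite (parcs H)"
    using fin by (meson finite_SigmaI finite_subset)
  show "fst e \<noteq> snd e" if eH: "e \<in> parcs H" for e
  proof -
    have "(fst e, snd e) \<in> parcs H" using eH by simp
    then show ?thesis
    proof (cases rule: arcs_H_cases)
      case (mid u v)
      then show ?thesis
        \<comment> \<open>A loop here would give \<open>ins (u, v) = ins (v, u)\<close>, hence
          \<open>u = v\<close> by injectivity. All other arcs join an old vertex to a new
          one.\<close>
        using inj_ins no_loops' by (metis inj_onD prod.inject)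
    next
      case (ins1 u v)
      then show ?thesis using in_arcsD1 ins_verts by (metis disjoint_iff image_eqI)
    next
      case (ins2 u v)
      then show ?thesis using in_arcsD1 ins_verts by (metis disjoint_iff image_eqI)
    next
      case (leaf1 v i)
      then show ?thesis using slot_vert leaf_verts by (metis disjoint_iff image_eqI)
    next
      case (leaf2 v i)
      then show ?thesis using slot_vert leaf_verts by (metis disjoint_iff image_eqI)
    qed
  qed
  show "symmetric H"
    using sym_H by (simp add: symmetric_def)
qed

lemma relpow_H:
  assumes "(u, v) \<in> parcs G ^^ n"
  shows "(u, v) \<in> parcs H ^^ (3 * n)"
  using assms
proof (induction n arbitrary: v)
  case (Suc n)
  then obtain w where w: "(u, w) \<in> parcs G ^^ n" "(w, v) \<in> parcs G"
    by (meson relpow_Suc_E)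
  have "(w, ins (w, v)) \<in> parcs H" "(ins (w, v), ins (v, w)) \<in> parcs H" "(ins (v, w), v) \<in> parcs H"
    using w(2) arcs_HI arcs_symmetric sym_H by (blast dest: symD)+
  then have "(u, v) \<in> parcs H ^^ Suc (Suc (Suc (3 * n)))"
    using Suc.IH[OF w(1)] by (meson relpow_Suc_I)
  then show ?case
    by (simp add: eval_nat_numeral)
qed simp

lemma near_old_vertex:
  assumes "x \<in> pverts H"
  shows "\<exists>v\<in>pverts G. \<exists>k\<le>1. (x, v) \<in> parcs H ^^ k"
proof -
  consider "x \<in> pverts G" | u v where "(u, v) \<in> parcs G" "x = ins (u, v)"
    | v i where "(v, i) \<in> leaf_slots G" "x = leaf (v, i)"
    using assms by (auto simp: pverts_H)
  then show ?thesis
  proof cases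
    case 1
    then show ?thesis by (intro bexI[of _ x] exI[of _ 0]) auto
  next
    case (2 u v)
    then have "(x, u) \<in> parcs H" "u \<in> pverts G"
      using arcs_HI(1) sym_H in_arcsD1 by (auto dest: symD)
    then show ?thesis by (intro bexI[of _ u] exI[of _ 1]) auto
  next
    case (3 v i)
    then have "(x, v) \<in> parcs H" "v \<in> pverts G"
      using arcs_HI(3) sym_H slot_vert by (auto dest: symD)
    then show ?thesis by (intro bexI[of _ v] exI[of _ 1]) auto
  qed
qed

lemma relpow_H_bound:
  assumes "\<forall>u\<in>pverts G. \<forall>v\<in>pverts G. \<exists>n\<le>D. (u, v) \<in> parcs G ^^ n"
    and "x \<in> pverts H" "y \<in> pverts H"
  shows "\<exists>n\<le>3 * D + 2. (x, y) \<in> parcs H ^^ n"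
proof -
  obtain u k where u: "u \<in> pverts G" "k \<le> 1" "(x, u) \<in> parcs H ^^ k"
    using near_old_vertex assms(2) by blast
  obtain v l where v: "v \<in> pverts G" "l \<le> 1" "(y, v) \<in> parcs H ^^ l"
    using near_old_vertex assms(3) by blast
  obtain n where n: "n \<le> D" "(u, v) \<in> parcs G ^^ n"
    using assms(1) u v by blast
  have "(v, y) \<in> parcs H ^^ l"
    using relpow_converse_sym[OF sym_H] v by blast
  then have "(x, y) \<in> parcs H ^^ (k + 3 * n + l)"
    using u(3) relpow_H[OF n(2)] unfolding relpow_add by blast
  moreover have "k + 3 * n + l \<le> 3 * D + 2"
    using u v n by simp
  ultimately show ?thesis by blast
qed

text \<open>Instead of analysing walks in \<open>H\<close>, the proof builds a function that changes
  by at most 1 along each arc of \<open>H\<close> and rises by at least \<open>3 * D + 2\<close>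
  between the two leaves.\<close>

lemma relpow_H_leaves:
  assumes a: "(a, 0) \<in> leaf_slots G" and b: "(b, 0) \<in> leaf_slots G" and ab: "a \<noteq> b"
    and reach: "\<And>v. v \<in> pverts G \<Longrightarrow> \<exists>n. (a, v) \<in> parcs G ^^ n"
    and far: "\<And>n. n < D \<Longrightarrow> (a, b) \<notin> parcs G ^^ n"
    and walk: "(leaf (a, 0), leaf (b, 0)) \<in> parcs H ^^ n"
  shows "3 * D + 2 \<le> n"
proof -
  \<comment> \<open>\<open>d\<close> is the distance from \<open>a\<close> in
    \<open>G\<close>.\<close>
  define d where "d v = (LEAST n. (a, v) \<in> parcs G ^^ n)" for v
  have d: "(a, v) \<in> parcs G ^^ d v" if "v \<in> pverts G" for v
    unfolding d_def using reach[OF that] by (rule LeastI_ex)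
  have d_le: "d v \<le> n" if "(a, v) \<in> parcs G ^^ n" for v n
    unfolding d_def using that by (rule Least_le)
  have d_step: "d v \<le> Suc (d u)" if "(u, v) \<in> parcs G" for u v
    using that d in_arcsD1 by (intro d_le) (blast intro: relpow_Suc_I)
  have "d a = 0"
    using d_le[of a 0] by simp
  have "D \<le> d b"
    using far d slot_vert[OF b] by (meson not_less)
  \<comment> \<open>\<open>f\<close> extends \<open>3 d\<close> from the old vertices to a 1-Lipschitz function on \<open>H\<close>. The leaf where the
    walk starts can be given the value \<open>-1\<close>, as its only neighbour is \<open>a\<close>.\<close>
  define f where "f x =
    (if x \<in> pverts G then 3 * int (d x)
     else if x \<in> ins ` parcs G then
       (case inv_into (parcs G) ins x of (u, v) \<Rightarrow> min (3 * int (d u) + 1) (3 * int (d v) + 2))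
     else if x = leaf (a, 0) then -1
     else 3 * int (d (fst (inv_into (leaf_slots G) leaf x))) + 1)" for x
  have f_old: "f v = 3 * int (d v)" if "v \<in> pverts G" for v
    using that by (simp add: f_def)
  \<comment> \<open>The inserted vertex is one step from \<open>u\<close> and two steps from
    \<open>v\<close>; the minimum compares the routes from \<open>a\<close> through either
    end.\<close>
  have f_ins: "f (ins (u, v)) = min (3 * int (d u) + 1) (3 * int (d v) + 2)"
    if "(u, v) \<in> parcs G" for u v
  proof -
    have "ins (u, v) \<notin> pverts G" "ins (u, v) \<in> ins ` parcs G"
      using that ins_verts by blast+
    then show ?thesis
      by (simp add: f_def inv_into_f_f[OF inj_ins that])
  qed
  \<comment> \<open>Injectivity of \<open>leaf\<close> keeps the value -1 away from any other leaf
    at \<open>a\<close>.\<close>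
  have f_leaf: "f (leaf (v, i)) = (if (v, i) = (a, 0) then -1 else 3 * int (d v) + 1)"
    if "(v, i) \<in> leaf_slots G" for v i
  proof -
    have "leaf (v, i) \<notin> pverts G" "leaf (v, i) \<notin> ins ` parcs G"
      using that leaf_verts ins_leaf by blast+
    moreover have "leaf (v, i) = leaf (a, 0) \<longleftrightarrow> (v, i) = (a, 0)"
      using inj_leaf that a by (auto dest: inj_onD)
    ultimately show ?thesis
      by (simp add: f_def inv_into_f_f[OF inj_leaf that])
  qed
  have lip: "f y \<le> f x + 1" if "(x, y) \<in> parcs H" for x y
    using that
  proof (cases rule: arcs_H_cases)
    case (ins1 u v)
    then show ?thesis using f_ins[of u v] f_old[of u] in_arcsD1 by simp
  next
    case (ins2 u v)
    \<comment> \<open>Against the second term of the minimum the claim is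
      \<open>3 * d u \<le> 3 * d v + 3\<close>, which is \<open>d_step\<close> for the arc from
      \<open>v\<close> to \<open>u\<close>.\<close>
    then show ?thesis
      using f_ins[of u v] f_old[of u] in_arcsD1 d_step[of v u] arcs_symmetric by fastforce
  next
    case (mid u v)
    then show ?thesis using f_ins[of u v] f_ins[of v u] by simp
  next
    case (leaf1 v i)
    then show ?thesis using f_leaf[of v i] f_old[of v] slot_vert by simp
  next
    case (leaf2 v i)
    \<comment> \<open>For the starting leaf the inequality is tight:
      \<open>f a = 0 = -1 + 1\<close>.\<close>
    then show ?thesis using f_leaf[of v i] f_old[of v] slot_vert \<open>d a = 0\<close> by auto
  qed
  \<comment> \<open>As \<open>a \<noteq> b\<close>, this reads
    \<open>3 * d b + 1 \<le> -1 + n\<close>, and \<open>d b\<close> is at least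
    \<open>D\<close>.\<close>
  have "f (leaf (b, 0)) \<le> f (leaf (a, 0)) + int n"
    using lip walk by (rule relpow_lipschitz)
  then show ?thesis
    using f_leaf[OF a] f_leaf[OF b] ab \<open>D \<le> d b\<close> by simp
qed

text \<open>\<open>D \<ge> 1\<close> makes the extremal vertices distinct, so both have neighbours
  and carry leaves. A one-vertex graph would receive no leaves and keep diameter 0.\<close>

lemma has_diameter_step:
  assumes G: "has_diameter G D" and D: "D \<ge> 1"
  shows "has_diameter H (3 * D + 2)"
proof -
  obtain a b where ab: "a \<in> pverts G" "b \<in> pverts G" "\<And>n. n < D \<Longrightarrow> (a, b) \<notin> parcs G ^^ n"
    using G by (auto simp: has_diameter_def)
  have reach: "\<forall>u\<in>pverts G. \<forall>v\<in>pverts G. \<exists>n\<le>D. (u, v) \<in> parcs G ^^ n"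
    using G by (auto simp: has_diameter_def)
  have "a \<noteq> b"
    using ab(3)[of 0] D by auto
  have slot: "(u, 0) \<in> leaf_slots G" if uv: "u \<in> pverts G" "v \<in> pverts G" "u \<noteq> v" for u v
  proof -
    obtain n where n: "(u, v) \<in> parcs G ^^ n"
      using reach uv by blast
    \<comment> \<open>A walk between distinct vertices is nonempty, and its first arc gives
      \<open>u\<close> a neighbour.\<close>
    then obtain m where "n = Suc m"
      using uv(3) by (cases n) auto
    then obtain w where "(u, w) \<in> parcs G"
      using n by (meson relpow_Suc_D2)
    then show ?thesis by (rule slot_0)
  qed
  have slots: "(a, 0) \<in> leaf_slots G" "(b, 0) \<in> leaf_slots G"
    using slot ab \<open>a \<noteq> b\<close> by metis+
  have "(leaf (a, 0), leaf (b, 0)) \<notin> parcs H ^^ n" if "n < 3 * D + 2" for n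
    using relpow_H_leaves[OF slots \<open>a \<noteq> b\<close>, of D n] reach ab that by (meson not_less)
  moreover have "leaf (a, 0) \<in> pverts H" "leaf (b, 0) \<in> pverts H"
    using slots by (auto simp: pverts_H)
  ultimately show ?thesis
    unfolding has_diameter_def using relpow_H_bound[OF reach] by blast
qed

end

section \<open>Iteration along the sequence\<close>

lemma algorithm_I_has_diameter:
  assumes "pair_graph G" "algorithm_I G H" "has_diameter G D" "D \<ge> 1"
  shows "pair_graph H" "has_diameter H (3 * D + 2)"
proof -
  from assms(2) have "\<exists>ins leaf. algorithm_I_step G H ins leaf"
    unfolding algorithm_I_def
    by (elim exE conjE, intro exI algorithm_I_step.intro algorithm_I_step_axioms.intro assms(1))
  then obtain ins leaf where "algorithm_I_step G H ins leaf" by blast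
  then interpret algorithm_I_step G H ins leaf .
  show "pair_graph H" by (rule pair_graph_H)
  show "has_diameter H (3 * D + 2)" using assms(3,4) by (rule has_diameter_step)
qed

theorem theorem4p3:
  fixes T :: "nat \<Rightarrow> 'a pair_pre_digraph" and t :: nat
  assumes "undirected_tree (T 0)"
    and "card (pverts (T 0)) \<ge> 2"
    and "\<And>s. algorithm_I (T s) (T (Suc s))"
  shows "graph_diameter (T t) = 3 ^ t * (graph_diameter (T 0) + 1) - 1"
proof -
  have T0: "pair_graph (T 0)" "connected (with_proj (T 0))"
    using assms(1) by (auto simp: undirected_tree_def)
  have diam: "graph_diameter G = D" if "pair_graph G" "has_diameter G D"
    for G :: "'a pair_pre_digraph" and D
  proof -
    interpret pair_graph G by fact
    show ?thesis using that(2) by (rule graph_diameter_eqI)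
  qed
  obtain D where D: "D \<ge> 1" "has_diameter (T 0) D"
    using pair_graph.has_diameter_exists[OF T0 assms(2)] by blast
  have "pair_graph (T t) \<and> has_diameter (T t) (3 ^ t * (D + 1) - 1)"
  proof (induction t)
    case 0
    then show ?case using T0 D by simp
  next
    case (Suc t)
    \<comment> \<open>This bound keeps the diameter positive for the next step and makes the
      truncated subtraction exact, so that \<open>3 * (x - 1) + 2 = 3 * x - 1\<close> with
      \<open>x = 3 ^ t * (D + 1)\<close>.\<close>
    have "(2::nat) \<le> 3 ^ t * (D + 1)"
      using D(1) mult_le_mono[of 1 "3 ^ t" 2 "D + 1"] by simp
    then have "1 \<le> 3 ^ t * (D + 1) - 1"
      and "3 * (3 ^ t * (D + 1) - 1) + 2 = 3 ^ Suc t * (D + 1) - 1"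
      by (simp_all add: diff_mult_distrib2 mult.assoc)
    then show ?case
      using algorithm_I_has_diameter[OF _ assms(3)] Suc.IH by metis
  qed
  \<comment> \<open>\<open>diam\<close> is applied twice: to \<open>T t\<close>, and to
    \<open>T 0\<close> to identify \<open>D\<close> with the diameter of the seed.\<close>
  then show ?thesis
    using diam T0(1) D(2) by metis
qed

end
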